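(* Let $(\bar M,\bar g,\bar J)$ be a locally bronze semi-Riemannian manifold. (a) There exists no proper screen generic lightlike submanifold $M$ of $\bar M$ which is coisotropic, isotropic or totally lightlike. (b) If $M$ is a screen generic lightlike submanifold of $\bar M$ which is isotropic, coisotropic or totally lightlike, then $M$ is an invariant lightlike submanifold, i.e. $\bar J(\mathrm{Rad}\,TM)=\mathrm{Rad}\,TM$ and $\bar J(S(TM))=S(TM)$.
   Context: Bronze manifold: a semi-Riemannian manifold $(\bar M,\bar g)$ (of constant index $q$, $1\le q\le \dim\bar M-1$) with a $(1,1)$-tensor field $\bar J$ satisfying $\bar J^2=3\bar J+I$ and $\bar g(\bar JX,Y)=\bar g(X,\bar JY)$; it is locally bronze if $\bar\nabla\bar J=0$ for the Levi-Civita connection $\bar\nabla$. Lightlike submanifold: $M\subset\bar M$ of dimension $d$ and codimension $n$ such that $\mathrm{Rad}\,TM=TM\cap TM^\perp$ is a distribution of constant rank $r>0$. One fixes a screen distribution $S(TM)$ with $TM=\mathrm{Rad}\,TM\perp S(TM)$ and a screen transversal bundle $S(TM^\perp)$ with $TM^\perp=\mathrm{Rad}\,TM\perp S(TM^\perp)$, and a lightlike transversal bundle $\mathrm{ltr}(TM)$ (locally spanned by $N_1,\dots,N_r$ in $S(TM^\perp)^\perp$, orthogonal to $S(TM)$, with $\bar g(N_i,\xi_j)=\delta_{ij}$, $\bar g(N_i,N_j)=0$ for a local basis $\xi_1,\dots,\xi_r$ of $\mathrm{Rad}\,TM$), so that $T\bar M|_M=(\mathrm{Rad}\,TM\oplus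 \mathrm{ltr}(TM))\perp S(TM)\perp S(TM^\perp)$. $M$ is coisotropic if $r=n<d$, i.e. $S(TM^\perp)=\{0\}$; isotropic if $r=d<n$, i.e. $S(TM)=\{0\}$; totally lightlike if $r=n=d$, i.e. $S(TM)=S(TM^\perp)=\{0\}$. Screen generic: $M$ is a screen generic lightlike submanifold of a locally bronze $\bar M$ if (1) $\bar J(\mathrm{Rad}\,TM)=\mathrm{Rad}\,TM$; (2) $B_o=\bar J(S(TM))\cap S(TM)$ is a non-degenerate distribution; there is then a complementary non-degenerate distribution $B'$ with $S(TM)=B_o\oplus B'$, and, when $B'\ne\{0\}$, $\bar J(B')\not\subseteq S(TM)$ and $\bar J(B')\not\subseteq S(TM^\perp)$; for $Y\in\Gamma(B')$ one has $\bar JY=fY+wY$ with $fY\in\Gamma(B')$, $wY\in\Gamma(S(TM^\perp))$. $M$ is proper if $B_o\ne\{0\}$ and $B'\ne\{0\}$. *)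

theory Defs
  imports "HOL-Analysis.Analysis"
begin

section \<open>Smooth manifolds\<close>

text \<open>\<open>smooth_on S f\<close> is only meant for open \<open>S\<close>: the derivatives are unrestricted
  derivatives at the points of \<open>S\<close>.\<close>

primrec Ck_on :: "nat \<Rightarrow> 'a::real_normed_vector set \<Rightarrow> ('a \<Rightarrow> 'b::real_normed_vector) \<Rightarrow> bool" where
  "Ck_on 0 S f \<longleftrightarrow> continuous_on S f"
| "Ck_on (Suc k) S f \<longleftrightarrow>
     (\<forall>x\<in>S. f differentiable (at x)) \<and> (\<forall>v. Ck_on k S (\<lambda>x. frechet_derivative f (at x) v))"

definition smooth_on :: "'a::real_normed_vector set \<Rightarrow> ('a \<Rightarrow> 'b::real_normed_vector) \<Rightarrow> bool" where
  "smooth_on S f \<longleftrightarrow> (\<forall>k. Ck_on k S f)"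

text \<open>A chart is a pair of its domain and its coordinate map. The values of the coordinate map
  outside the domain are irrelevant. A manifold is a whole (Hausdorff, second countable) type
  \<open>'m\<close> together with an atlas with values in \<open>'a\<close>; its dimension is \<open>DIM('a)\<close>.\<close>

type_synonym ('m, 'a) chart = "'m set \<times> ('m \<Rightarrow> 'a)"

abbreviation chart_dom :: "('m, 'a) chart \<Rightarrow> 'm set" where
  "chart_dom c \<equiv> fst c"

abbreviation chart_map :: "('m, 'a) chart \<Rightarrow> 'm \<Rightarrow> 'a" where
  "chart_map c \<equiv> snd c"

definition chart_inv :: "('m, 'a) chart \<Rightarrow> 'a \<Rightarrow> 'm" where
  "chart_inv c = inv_into (chart_dom c) (chart_map c)"

definition is_chart :: "('m::topological_space, 'a::euclidean_space) chart \<Rightarrow> bool" where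
  "is_chart c \<longleftrightarrow>
     open (chart_dom c) \<and> open (chart_map c ` chart_dom c) \<and>
     homeomorphism (chart_dom c) (chart_map c ` chart_dom c) (chart_map c) (chart_inv c)"

definition smooth_atlas ::
  "('m::{t2_space, second_countable_topology}, 'a::euclidean_space) chart set \<Rightarrow> bool" where
  "smooth_atlas A \<longleftrightarrow>
     (\<forall>c\<in>A. is_chart c) \<and> (\<Union>c\<in>A. chart_dom c) = UNIV \<and>
     (\<forall>c\<in>A. \<forall>c'\<in>A. smooth_on (chart_map c ` (chart_dom c \<inter> chart_dom c')) (chart_map c' \<circ> chart_inv c))"

text \<open>The tangent space at \<open>p\<close> is the model space \<open>'a\<close>: the vector \<open>v :: 'a\<close> stands for the
  tangent vector at \<open>p\<close> with coordinates \<open>v\<close> in the chart \<open>chart_at A p\<close>. Its coordinates in any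
  other chart \<open>c\<close> around \<open>p\<close> are \<open>tcoord A c p v\<close>. Thus a vector field is a function \<open>'m \<Rightarrow> 'a\<close>,
  and smoothness has to be tested on the representations in the charts.\<close>

definition chart_at :: "('m, 'a) chart set \<Rightarrow> 'm \<Rightarrow> ('m, 'a) chart" where
  "chart_at A p = (SOME c. c \<in> A \<and> p \<in> chart_dom c)"

definition tcoord :: "('m, 'a::euclidean_space) chart set \<Rightarrow> ('m, 'a) chart \<Rightarrow> 'm \<Rightarrow> 'a \<Rightarrow> 'a" where
  "tcoord A c p =
     frechet_derivative (chart_map c \<circ> chart_inv (chart_at A p)) (at (chart_map (chart_at A p) p))"

definition smooth_functions :: "('m, 'a::euclidean_space) chart set \<Rightarrow> ('m \<Rightarrow> real) set" where
  "smooth_functions A = {f. \<forall>c\<in>A. smooth_on (chart_map c ` chart_dom c) (f \<circ> chart_inv c)}"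

definition vector_fields :: "('m, 'a::euclidean_space) chart set \<Rightarrow> ('m \<Rightarrow> 'a) set" where
  "vector_fields A =
     {X. \<forall>c\<in>A. smooth_on (chart_map c ` chart_dom c)
                 (\<lambda>x. tcoord A c (chart_inv c x) (X (chart_inv c x)))}"

text \<open>\<open>lie_deriv A X f\<close> is the function \<open>X f\<close>.\<close>

definition lie_deriv ::
  "('m, 'a::euclidean_space) chart set \<Rightarrow> ('m \<Rightarrow> 'a) \<Rightarrow> ('m \<Rightarrow> real) \<Rightarrow> 'm \<Rightarrow> real" where
  "lie_deriv A X f p =
     frechet_derivative (f \<circ> chart_inv (chart_at A p)) (at (chart_map (chart_at A p) p)) (X p)"

definition smooth_map ::
  "('k::topological_space, 'b::euclidean_space) chart set \<Rightarrow>
   ('m::topological_space, 'a::euclidean_space) chart set \<Rightarrow> ('k \<Rightarrow> 'm) \<Rightarrow> bool" where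
  "smooth_map B A F \<longleftrightarrow> continuous_on UNIV F \<and>
     (\<forall>b\<in>B. \<forall>c\<in>A. smooth_on (chart_map b ` (chart_dom b \<inter> F -` chart_dom c))
                    (chart_map c \<circ> F \<circ> chart_inv b))"

definition differential ::
  "('k, 'b::euclidean_space) chart set \<Rightarrow> ('m, 'a::euclidean_space) chart set \<Rightarrow>
   ('k \<Rightarrow> 'm) \<Rightarrow> 'k \<Rightarrow> 'b \<Rightarrow> 'a" where
  "differential B A F p =
     frechet_derivative (chart_map (chart_at A (F p)) \<circ> F \<circ> chart_inv (chart_at B p))
       (at (chart_map (chart_at B p) p))"

section \<open>Semi-Riemannian and bronze manifolds\<close>

definition nondegenerate_on :: "('a::euclidean_space \<Rightarrow> 'a \<Rightarrow> real) \<Rightarrow> 'a set \<Rightarrow> bool" where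
  "nondegenerate_on \<beta> W \<longleftrightarrow> (\<forall>v\<in>W. (\<forall>w\<in>W. \<beta> v w = 0) \<longrightarrow> v = 0)"

definition negative_definite_on :: "('a::euclidean_space \<Rightarrow> 'a \<Rightarrow> real) \<Rightarrow> 'a set \<Rightarrow> bool" where
  "negative_definite_on \<beta> W \<longleftrightarrow> (\<forall>v\<in>W. v \<noteq> 0 \<longrightarrow> \<beta> v v < 0)"

definition has_index :: "('a::euclidean_space \<Rightarrow> 'a \<Rightarrow> real) \<Rightarrow> nat \<Rightarrow> bool" where
  "has_index \<beta> q \<longleftrightarrow>
     (\<exists>W. subspace W \<and> negative_definite_on \<beta> W \<and> dim W = q) \<and>
     (\<forall>W. subspace W \<and> negative_definite_on \<beta> W \<longrightarrow> dim W \<le> q)"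

definition semi_riemannian ::
  "('m::{t2_space, second_countable_topology}, 'a::euclidean_space) chart set \<Rightarrow>
   ('m \<Rightarrow> 'a \<Rightarrow> 'a \<Rightarrow> real) \<Rightarrow> nat \<Rightarrow> bool" where
  "semi_riemannian A g q \<longleftrightarrow>
     smooth_atlas A \<and>
     (\<forall>p. bilinear (g p) \<and> (\<forall>v w. g p v w = g p w v) \<and>
          nondegenerate_on (g p) UNIV \<and> has_index (g p) q) \<and>
     (\<forall>X\<in>vector_fields A. \<forall>Y\<in>vector_fields A. (\<lambda>p. g p (X p) (Y p)) \<in> smooth_functions A)"

definition affine_connection ::
  "('m, 'a::euclidean_space) chart set \<Rightarrow> (('m \<Rightarrow> 'a) \<Rightarrow> ('m \<Rightarrow> 'a) \<Rightarrow> 'm \<Rightarrow> 'a) \<Rightarrow> bool" where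
  "affine_connection A nabla \<longleftrightarrow>
     (\<forall>X\<in>vector_fields A. \<forall>Y\<in>vector_fields A. nabla X Y \<in> vector_fields A) \<and>
     (\<forall>X\<in>vector_fields A. \<forall>X'\<in>vector_fields A. \<forall>Y\<in>vector_fields A. \<forall>p.
        nabla (\<lambda>x. X x + X' x) Y p = nabla X Y p + nabla X' Y p) \<and>
     (\<forall>f\<in>smooth_functions A. \<forall>X\<in>vector_fields A. \<forall>Y\<in>vector_fields A. \<forall>p.
        nabla (\<lambda>x. f x *\<^sub>R X x) Y p = f p *\<^sub>R nabla X Y p) \<and>
     (\<forall>X\<in>vector_fields A. \<forall>Y\<in>vector_fields A. \<forall>Y'\<in>vector_fields A. \<forall>p.
        nabla X (\<lambda>x. Y x + Y' x) p = nabla X Y p + nabla X Y' p) \<and>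
     (\<forall>f\<in>smooth_functions A. \<forall>X\<in>vector_fields A. \<forall>Y\<in>vector_fields A. \<forall>p.
        nabla X (\<lambda>x. f x *\<^sub>R Y x) p = lie_deriv A X f p *\<^sub>R Y p + f p *\<^sub>R nabla X Y p)"

text \<open>The second clause says that the torsion vanishes: the vector field
  \<open>nabla X Y - nabla Y X\<close> acts on functions as the commutator \<open>[X, Y]\<close>.\<close>

definition levi_civita ::
  "('m, 'a::euclidean_space) chart set \<Rightarrow> ('m \<Rightarrow> 'a \<Rightarrow> 'a \<Rightarrow> real) \<Rightarrow>
   (('m \<Rightarrow> 'a) \<Rightarrow> ('m \<Rightarrow> 'a) \<Rightarrow> 'm \<Rightarrow> 'a) \<Rightarrow> bool" where
  "levi_civita A g nabla \<longleftrightarrow>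
     affine_connection A nabla \<and>
     (\<forall>X\<in>vector_fields A. \<forall>Y\<in>vector_fields A. \<forall>f\<in>smooth_functions A. \<forall>p.
        lie_deriv A (\<lambda>x. nabla X Y x - nabla Y X x) f p =
        lie_deriv A X (lie_deriv A Y f) p - lie_deriv A Y (lie_deriv A X f) p) \<and>
     (\<forall>X\<in>vector_fields A. \<forall>Y\<in>vector_fields A. \<forall>Z\<in>vector_fields A. \<forall>p.
        lie_deriv A X (\<lambda>x. g x (Y x) (Z x)) p = g p (nabla X Y p) (Z p) + g p (Y p) (nabla X Z p))"

definition bronze ::
  "('m::{t2_space, second_countable_topology}, 'a::euclidean_space) chart set \<Rightarrow>
   ('m \<Rightarrow> 'a \<Rightarrow> 'a \<Rightarrow> real) \<Rightarrow> nat \<Rightarrow> ('m \<Rightarrow> 'a \<Rightarrow> 'a) \<Rightarrow> bool" where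
  "bronze A g q J \<longleftrightarrow>
     semi_riemannian A g q \<and> 1 \<le> q \<and> q \<le> DIM('a) - 1 \<and>
     (\<forall>p. linear (J p)) \<and>
     (\<forall>X\<in>vector_fields A. (\<lambda>p. J p (X p)) \<in> vector_fields A) \<and>
     (\<forall>p v. J p (J p v) = 3 *\<^sub>R J p v + v) \<and>
     (\<forall>p v w. g p (J p v) w = g p v (J p w))"

text \<open>The last clause is \<open>(nabla_X J) Y = 0\<close>. On smooth vector fields the Levi-Civita connection
  is unique.\<close>

definition locally_bronze ::
  "('m::{t2_space, second_countable_topology}, 'a::euclidean_space) chart set \<Rightarrow>
   ('m \<Rightarrow> 'a \<Rightarrow> 'a \<Rightarrow> real) \<Rightarrow> nat \<Rightarrow> ('m \<Rightarrow> 'a \<Rightarrow> 'a) \<Rightarrow> bool" where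
  "locally_bronze A g q J \<longleftrightarrow>
     bronze A g q J \<and>
     (\<exists>nabla. levi_civita A g nabla \<and>
        (\<forall>X\<in>vector_fields A. \<forall>Y\<in>vector_fields A. \<forall>p.
           nabla X (\<lambda>x. J x (Y x)) p - J p (nabla X Y p) = 0))"

section \<open>Submanifolds and distributions along them\<close>

text \<open>A submanifold is an injectively immersed manifold \<open>\<iota> : 'k \<Rightarrow> 'm\<close>; embedded submanifolds are
  the case where \<open>\<iota>\<close> is a homeomorphism onto its image. Its tangent spaces, and the fibres of all
  other bundles over it, are subspaces of the tangent spaces of the ambient manifold.\<close>

definition submanifold ::
  "('m::{t2_space, second_countable_topology}, 'a::euclidean_space) chart set \<Rightarrow>
   ('k::{t2_space, second_countable_topology}, 'b::euclidean_space) chart set \<Rightarrow>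
   ('k \<Rightarrow> 'm) \<Rightarrow> bool" where
  "submanifold A B \<iota> \<longleftrightarrow>
     smooth_atlas A \<and> smooth_atlas B \<and> smooth_map B A \<iota> \<and> inj \<iota> \<and>
     (\<forall>p. inj (differential B A \<iota> p))"

definition tangent_space ::
  "('m, 'a::euclidean_space) chart set \<Rightarrow> ('k, 'b::euclidean_space) chart set \<Rightarrow>
   ('k \<Rightarrow> 'm) \<Rightarrow> 'k \<Rightarrow> 'a set" where
  "tangent_space A B \<iota> p = range (differential B A \<iota> p)"

definition normal_space ::
  "('m, 'a::euclidean_space) chart set \<Rightarrow> ('m \<Rightarrow> 'a \<Rightarrow> 'a \<Rightarrow> real) \<Rightarrow>
   ('k, 'b::euclidean_space) chart set \<Rightarrow> ('k \<Rightarrow> 'm) \<Rightarrow> 'k \<Rightarrow> 'a set" where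
  "normal_space A g B \<iota> p = {v. \<forall>w\<in>tangent_space A B \<iota> p. g (\<iota> p) v w = 0}"

definition radical ::
  "('m, 'a::euclidean_space) chart set \<Rightarrow> ('m \<Rightarrow> 'a \<Rightarrow> 'a \<Rightarrow> real) \<Rightarrow>
   ('k, 'b::euclidean_space) chart set \<Rightarrow> ('k \<Rightarrow> 'm) \<Rightarrow> 'k \<Rightarrow> 'a set" where
  "radical A g B \<iota> p = tangent_space A B \<iota> p \<inter> normal_space A g B \<iota> p"

text \<open>Smoothness on the open set \<open>V\<close> of a vector field along \<open>\<iota>\<close>, i.e. of a section of the
  pulled back ambient tangent bundle.\<close>

definition smooth_along ::
  "('m, 'a::euclidean_space) chart set \<Rightarrow> ('k, 'b::euclidean_space) chart set \<Rightarrow>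
   ('k \<Rightarrow> 'm) \<Rightarrow> 'k set \<Rightarrow> ('k \<Rightarrow> 'a) \<Rightarrow> bool" where
  "smooth_along A B \<iota> V X \<longleftrightarrow>
     (\<forall>b\<in>B. \<forall>c\<in>A. smooth_on (chart_map b ` (V \<inter> chart_dom b \<inter> \<iota> -` chart_dom c))
        (\<lambda>x. tcoord A c (\<iota> (chart_inv b x)) (X (chart_inv b x))))"

definition sections ::
  "('m, 'a::euclidean_space) chart set \<Rightarrow> ('k, 'b::euclidean_space) chart set \<Rightarrow>
   ('k \<Rightarrow> 'm) \<Rightarrow> 'k set \<Rightarrow> ('k \<Rightarrow> 'a set) \<Rightarrow> ('k \<Rightarrow> 'a) set" where
  "sections A B \<iota> V D = {X. smooth_along A B \<iota> V X \<and> (\<forall>x\<in>V. X x \<in> D x)}"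

definition local_frame ::
  "('m, 'a::euclidean_space) chart set \<Rightarrow> ('k::topological_space, 'b::euclidean_space) chart set \<Rightarrow>
   ('k \<Rightarrow> 'm) \<Rightarrow> 'k set \<Rightarrow> nat \<Rightarrow> (nat \<Rightarrow> 'k \<Rightarrow> 'a) \<Rightarrow> ('k \<Rightarrow> 'a set) \<Rightarrow> bool" where
  "local_frame A B \<iota> V k E D \<longleftrightarrow>
     open V \<and> (\<forall>i<k. E i \<in> sections A B \<iota> V D) \<and>
     (\<forall>x\<in>V. inj_on (\<lambda>i. E i x) {..<k} \<and> independent ((\<lambda>i. E i x) ` {..<k}) \<and>
             span ((\<lambda>i. E i x) ` {..<k}) = D x)"

definition distribution_of_rank ::
  "('m, 'a::euclidean_space) chart set \<Rightarrow> ('k::topological_space, 'b::euclidean_space) chart set \<Rightarrow>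
   ('k \<Rightarrow> 'm) \<Rightarrow> nat \<Rightarrow> ('k \<Rightarrow> 'a set) \<Rightarrow> bool" where
  "distribution_of_rank A B \<iota> k D \<longleftrightarrow> (\<forall>p. \<exists>V E. p \<in> V \<and> local_frame A B \<iota> V k E D)"

definition smooth_distribution ::
  "('m, 'a::euclidean_space) chart set \<Rightarrow> ('k::topological_space, 'b::euclidean_space) chart set \<Rightarrow>
   ('k \<Rightarrow> 'm) \<Rightarrow> ('k \<Rightarrow> 'a set) \<Rightarrow> bool" where
  "smooth_distribution A B \<iota> D \<longleftrightarrow> (\<exists>k. distribution_of_rank A B \<iota> k D)"

definition nondegenerate_distribution ::
  "('m, 'a::euclidean_space) chart set \<Rightarrow> ('m \<Rightarrow> 'a \<Rightarrow> 'a \<Rightarrow> real) \<Rightarrow>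
   ('k::topological_space, 'b::euclidean_space) chart set \<Rightarrow>
   ('k \<Rightarrow> 'm) \<Rightarrow> ('k \<Rightarrow> 'a set) \<Rightarrow> bool" where
  "nondegenerate_distribution A g B \<iota> D \<longleftrightarrow>
     smooth_distribution A B \<iota> D \<and> (\<forall>p. nondegenerate_on (g (\<iota> p)) (D p))"

definition direct_sum :: "'a::euclidean_space set \<Rightarrow> 'a set \<Rightarrow> 'a set \<Rightarrow> bool" where
  "direct_sum W U V \<longleftrightarrow> W = {u + v | u v. u \<in> U \<and> v \<in> V} \<and> U \<inter> V = {0}"

definition orthogonal_sum ::
  "('a::euclidean_space \<Rightarrow> 'a \<Rightarrow> real) \<Rightarrow> 'a set \<Rightarrow> 'a set \<Rightarrow> 'a set \<Rightarrow> bool" where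
  "orthogonal_sum \<beta> W U V \<longleftrightarrow> direct_sum W U V \<and> (\<forall>u\<in>U. \<forall>v\<in>V. \<beta> u v = 0)"

section \<open>Lightlike submanifolds\<close>

text \<open>\<open>S\<close>, \<open>S'\<close> and \<open>L\<close> are the screen distribution \<open>S(TM)\<close>, the screen transversal bundle
  \<open>S(TM\<^sup>\<bottom>)\<close> and the lightlike transversal bundle \<open>ltr(TM)\<close>; \<open>r\<close> is the rank of \<open>Rad TM\<close>.\<close>

definition lightlike_submanifold ::
  "('m::{t2_space, second_countable_topology}, 'a::euclidean_space) chart set \<Rightarrow>
   ('m \<Rightarrow> 'a \<Rightarrow> 'a \<Rightarrow> real) \<Rightarrow>
   ('k::{t2_space, second_countable_topology}, 'b::euclidean_space) chart set \<Rightarrow>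
   ('k \<Rightarrow> 'm) \<Rightarrow> ('k \<Rightarrow> 'a set) \<Rightarrow> ('k \<Rightarrow> 'a set) \<Rightarrow> ('k \<Rightarrow> 'a set) \<Rightarrow> nat \<Rightarrow> bool" where
  "lightlike_submanifold A g B \<iota> S S' L r \<longleftrightarrow>
     submanifold A B \<iota> \<and>
     0 < r \<and> distribution_of_rank A B \<iota> r (radical A g B \<iota>) \<and>
     smooth_distribution A B \<iota> S \<and>
     (\<forall>p. orthogonal_sum (g (\<iota> p)) (tangent_space A B \<iota> p) (radical A g B \<iota> p) (S p)) \<and>
     smooth_distribution A B \<iota> S' \<and>
     (\<forall>p. orthogonal_sum (g (\<iota> p)) (normal_space A g B \<iota> p) (radical A g B \<iota> p) (S' p)) \<and>
     (\<forall>p. \<exists>V \<xi> N. p \<in> V \<and>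
        local_frame A B \<iota> V r \<xi> (radical A g B \<iota>) \<and> local_frame A B \<iota> V r N L \<and>
        (\<forall>x\<in>V. \<forall>i<r.
           (\<forall>w\<in>S' x. g (\<iota> x) (N i x) w = 0) \<and>
           (\<forall>w\<in>S x. g (\<iota> x) (N i x) w = 0) \<and>
           (\<forall>j<r. g (\<iota> x) (N i x) (\<xi> j x) = (if i = j then 1 else 0) \<and>
                  g (\<iota> x) (N i x) (N j x) = 0)))"

text \<open>The arguments are the rank \<open>r\<close> of the radical distribution, the dimension \<open>d\<close> and the
  codimension \<open>n\<close>.\<close>

definition coisotropic :: "nat \<Rightarrow> nat \<Rightarrow> nat \<Rightarrow> bool" where
  "coisotropic r d n \<longleftrightarrow> r = n \<and> n < d"

definition isotropic :: "nat \<Rightarrow> nat \<Rightarrow> nat \<Rightarrow> bool" where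
  "isotropic r d n \<longleftrightarrow> r = d \<and> d < n"

definition totally_lightlike :: "nat \<Rightarrow> nat \<Rightarrow> nat \<Rightarrow> bool" where
  "totally_lightlike r d n \<longleftrightarrow> r = n \<and> n = d"

definition Bo :: "('m \<Rightarrow> 'a \<Rightarrow> 'a) \<Rightarrow> ('k \<Rightarrow> 'm) \<Rightarrow> ('k \<Rightarrow> 'a set) \<Rightarrow> 'k \<Rightarrow> 'a set" where
  "Bo J \<iota> S p = J (\<iota> p) ` S p \<inter> S p"

text \<open>Screen generic with the complementary distribution \<open>B'\<close>. Inclusions between bundles are
  inclusions of all fibres, so a failing inclusion fails at some point; likewise, a bundle is
  nonzero if some fibre is. The decomposition \<open>J Y = f Y + w Y\<close> is required for sections over
  arbitrary open sets.\<close>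

definition screen_generic_wrt ::
  "('m::{t2_space, second_countable_topology}, 'a::euclidean_space) chart set \<Rightarrow>
   ('m \<Rightarrow> 'a \<Rightarrow> 'a \<Rightarrow> real) \<Rightarrow> ('m \<Rightarrow> 'a \<Rightarrow> 'a) \<Rightarrow>
   ('k::{t2_space, second_countable_topology}, 'b::euclidean_space) chart set \<Rightarrow>
   ('k \<Rightarrow> 'm) \<Rightarrow> ('k \<Rightarrow> 'a set) \<Rightarrow> ('k \<Rightarrow> 'a set) \<Rightarrow> ('k \<Rightarrow> 'a set) \<Rightarrow> nat \<Rightarrow>
   ('k \<Rightarrow> 'a set) \<Rightarrow> bool" where
  "screen_generic_wrt A g J B \<iota> S S' L r B' \<longleftrightarrow>
     lightlike_submanifold A g B \<iota> S S' L r \<and>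
     (\<forall>p. J (\<iota> p) ` radical A g B \<iota> p = radical A g B \<iota> p) \<and>
     nondegenerate_distribution A g B \<iota> (Bo J \<iota> S) \<and>
     nondegenerate_distribution A g B \<iota> B' \<and>
     (\<forall>p. direct_sum (S p) (Bo J \<iota> S p) (B' p)) \<and>
     ((\<exists>p. B' p \<noteq> {0}) \<longrightarrow>
        \<not> (\<forall>p. J (\<iota> p) ` B' p \<subseteq> S p) \<and> \<not> (\<forall>p. J (\<iota> p) ` B' p \<subseteq> S' p)) \<and>
     (\<forall>V. open V \<longrightarrow> (\<forall>Y\<in>sections A B \<iota> V B'.
        \<exists>fY\<in>sections A B \<iota> V B'. \<exists>wY\<in>sections A B \<iota> V S'. \<forall>x\<in>V. J (\<iota> x) (Y x) = fY x + wY x))"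

definition screen_generic ::
  "('m::{t2_space, second_countable_topology}, 'a::euclidean_space) chart set \<Rightarrow>
   ('m \<Rightarrow> 'a \<Rightarrow> 'a \<Rightarrow> real) \<Rightarrow> ('m \<Rightarrow> 'a \<Rightarrow> 'a) \<Rightarrow>
   ('k::{t2_space, second_countable_topology}, 'b::euclidean_space) chart set \<Rightarrow>
   ('k \<Rightarrow> 'm) \<Rightarrow> ('k \<Rightarrow> 'a set) \<Rightarrow> ('k \<Rightarrow> 'a set) \<Rightarrow> ('k \<Rightarrow> 'a set) \<Rightarrow> nat \<Rightarrow> bool" where
  "screen_generic A g J B \<iota> S S' L r \<longleftrightarrow> (\<exists>B'. screen_generic_wrt A g J B \<iota> S S' L r B')"

definition proper_screen_generic ::
  "('m::{t2_space, second_countable_topology}, 'a::euclidean_space) chart set \<Rightarrow>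
   ('m \<Rightarrow> 'a \<Rightarrow> 'a \<Rightarrow> real) \<Rightarrow> ('m \<Rightarrow> 'a \<Rightarrow> 'a) \<Rightarrow>
   ('k::{t2_space, second_countable_topology}, 'b::euclidean_space) chart set \<Rightarrow>
   ('k \<Rightarrow> 'm) \<Rightarrow> ('k \<Rightarrow> 'a set) \<Rightarrow> ('k \<Rightarrow> 'a set) \<Rightarrow> ('k \<Rightarrow> 'a set) \<Rightarrow> nat \<Rightarrow> bool" where
  "proper_screen_generic A g J B \<iota> S S' L r \<longleftrightarrow>
     (\<exists>B'. screen_generic_wrt A g J B \<iota> S S' L r B' \<and>
           (\<exists>p. Bo J \<iota> S p \<noteq> {0}) \<and> (\<exists>p. B' p \<noteq> {0}))"

definition invariant_lightlike ::
  "('m::{t2_space, second_countable_topology}, 'a::euclidean_space) chart set \<Rightarrow>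
   ('m \<Rightarrow> 'a \<Rightarrow> 'a \<Rightarrow> real) \<Rightarrow> ('m \<Rightarrow> 'a \<Rightarrow> 'a) \<Rightarrow>
   ('k::{t2_space, second_countable_topology}, 'b::euclidean_space) chart set \<Rightarrow>
   ('k \<Rightarrow> 'm) \<Rightarrow> ('k \<Rightarrow> 'a set) \<Rightarrow> ('k \<Rightarrow> 'a set) \<Rightarrow> ('k \<Rightarrow> 'a set) \<Rightarrow> nat \<Rightarrow> bool" where
  "invariant_lightlike A g J B \<iota> S S' L r \<longleftrightarrow>
     lightlike_submanifold A g B \<iota> S S' L r \<and>
     (\<forall>p. J (\<iota> p) ` radical A g B \<iota> p = radical A g B \<iota> p) \<and>
     (\<forall>p. J (\<iota> p) ` S p = S p)"

end

theory Submission
  imports Defs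
begin

text \<open>Count dimensions in a fibre. If the radical has the rank of \<open>TM\<close>, then \<open>S(TM) = 0\<close> and with
  it \<open>B' = 0\<close>. If it has the codimension of \<open>M\<close> as its rank, then it fills \<open>TM\<^sup>\<bottom>\<close>, so
  \<open>S(TM\<^sup>\<bottom>) = 0\<close>; hence \<open>wY = 0\<close> and \<open>J\<close> maps \<open>B'\<close> into \<open>B' \<subseteq> S(TM)\<close>, which the definition of
  screen genericity forbids unless \<open>B' = 0\<close>. In all cases \<open>S(TM) = B\<^sub>o \<subseteq> J(S(TM))\<close>, and this is
  an equality since \<open>J\<close> cannot raise the dimension.\<close>

section \<open>Fibres of distributions and direct sums\<close>

lemma local_frame_subspace:
  assumes "local_frame A B \<iota> V k E D" "x \<in> V"
  shows "subspace (D x)"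
  using assms unfolding local_frame_def by (metis subspace_span)

text \<open>A distribution is declared as a mere family of sets; its fibres are subspaces because a
  local frame spans each of them.\<close>

lemma distribution_of_rank_subspace:
  "distribution_of_rank A B \<iota> k D \<Longrightarrow> subspace (D p)"
  unfolding distribution_of_rank_def by (meson local_frame_subspace)

lemma smooth_distribution_subspace:
  "smooth_distribution A B \<iota> D \<Longrightarrow> subspace (D p)"
  unfolding smooth_distribution_def by (meson distribution_of_rank_subspace)

text \<open>A frame is an indexed family, while \<open>independent\<close> speaks of its set of
  values. Injectivity of the indexing ensures that this basis really has \<open>k\<close>
  elements.\<close>

lemma distribution_of_rank_dim:
  assumes "distribution_of_rank A B \<iota> k D"
  shows "dim (D p) = k"
proof -
  obtain V E where "p \<in> V" and E: "local_frame A B \<iota> V k E D"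
    using assms unfolding distribution_of_rank_def by blast
  then have inj: "inj_on (\<lambda>i. E i p) {..<k}" and ind: "independent ((\<lambda>i. E i p) ` {..<k})"
    and span: "span ((\<lambda>i. E i p) ` {..<k}) = D p"
    unfolding local_frame_def by auto
  have "dim (D p) = card ((\<lambda>i. E i p) ` {..<k})"
    using dim_span_eq_card_independent[OF ind] span by simp
  then show ?thesis
    using card_image[OF inj] by simp
qed

text \<open>\<open>direct_sum\<close> does not ask the summands to be subspaces, but the clause that
  they intersect in \<open>{0}\<close> puts 0 into both, and each vector can be written as its own
  sum with 0.\<close>

lemma direct_sum_subset:
  assumes "direct_sum W U V"
  shows "U \<subseteq> W" "V \<subseteq> W"
proof -
  have W: "W = {u + v | u v. u \<in> U \<and> v \<in> V}" and "0 \<in> U" "0 \<in> V"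
    using assms unfolding direct_sum_def by auto
  show "U \<subseteq> W"
    unfolding W using \<open>0 \<in> V\<close> by force
  show "V \<subseteq> W"
    unfolding W using \<open>0 \<in> U\<close> by force
qed

lemma direct_sum_full_left:
  assumes "direct_sum W U V" "U = W"
  shows "V = {0}"
  using direct_sum_subset(2)[OF assms(1)] assms unfolding direct_sum_def by blast

lemma direct_sum_zero_right:
  "direct_sum W U {0} \<Longrightarrow> W = U"
  unfolding direct_sum_def by auto

section \<open>Tangent spaces of the submanifold\<close>

lemma chart_at_in:
  assumes "smooth_atlas A"
  shows "chart_at A p \<in> A" "p \<in> chart_dom (chart_at A p)"
proof -
  have "\<exists>c. c \<in> A \<and> p \<in> chart_dom c"
    using assms unfolding smooth_atlas_def by blast
  from someI_ex[OF this] show "chart_at A p \<in> A" "p \<in> chart_dom (chart_at A p)"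
    unfolding chart_at_def by auto
qed

lemma smooth_on_differentiable:
  assumes "smooth_on S f" "x \<in> S"
  shows "f differentiable (at x)"
proof -
  have "Ck_on (Suc 0) S f"
    using assms(1) unfolding smooth_on_def by blast
  then show ?thesis
    using assms(2) by simp
qed

text \<open>\<open>frechet_derivative\<close> is a choice that is known to be linear only where the
  map is differentiable. Differentiability comes from the smoothness of the coordinate
  representation of \<open>\<iota>\<close> in the two chosen charts, whose domains contain
  \<open>p\<close> and \<open>\<iota> p\<close>.\<close>

lemma linear_differential:
  assumes "submanifold A B \<iota>"
  shows "linear (differential B A \<iota> p)"
proof -
  let ?b = "chart_at B p" and ?c = "chart_at A (\<iota> p)"
  have atlas: "smooth_atlas A" "smooth_atlas B" and "smooth_map B A \<iota>"
    using assms unfolding submanifold_def by auto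
  then have "smooth_on (chart_map ?b ` (chart_dom ?b \<inter> \<iota> -` chart_dom ?c))
      (chart_map ?c \<circ> \<iota> \<circ> chart_inv ?b)"
    unfolding smooth_map_def using chart_at_in(1)[OF atlas(1)] chart_at_in(1)[OF atlas(2)] by blast
  moreover have "chart_map ?b p \<in> chart_map ?b ` (chart_dom ?b \<inter> \<iota> -` chart_dom ?c)"
    using chart_at_in(2)[OF atlas(1)] chart_at_in(2)[OF atlas(2)] by blast
  ultimately have "(chart_map ?c \<circ> \<iota> \<circ> chart_inv ?b) differentiable (at (chart_map ?b p))"
    by (rule smooth_on_differentiable)
  then show ?thesis
    unfolding differential_def by (rule linear_frechet_derivative)
qed

lemma
  fixes A :: "('m::{t2_space, second_countable_topology}, 'a::euclidean_space) chart set"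
    and B :: "('k::{t2_space, second_countable_topology}, 'b::euclidean_space) chart set"
  assumes "submanifold A B \<iota>"
  shows subspace_tangent_space: "subspace (tangent_space A B \<iota> p)"
    and dim_tangent_space: "dim (tangent_space A B \<iota> p) = DIM('b)"
proof -
  have lin: "linear (differential B A \<iota> p)"
    using assms by (rule linear_differential)
  show "subspace (tangent_space A B \<iota> p)"
    unfolding tangent_space_def using lin by (rule linear_subspace_image) (rule subspace_UNIV)
  have "inj (differential B A \<iota> p)"
    using assms unfolding submanifold_def by blast
  then show "dim (tangent_space A B \<iota> p) = DIM('b)"
    unfolding tangent_space_def using dim_image_eq[OF lin, of UNIV] by simp
qed

section \<open>Linear algebra of nondegenerate forms\<close>

lemma bilinear_subspace_complement:
  assumes "bilinear \<beta>"
  shows "subspace {v. \<forall>w\<in>W. \<beta> v w = 0}"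
  by (auto simp: subspace_def bilinear_lzero[OF assms] bilinear_ladd[OF assms]
      bilinear_lmul[OF assms])

text \<open>The form is compared with the Euclidean inner product: nondegeneracy gives an injective
  linear map from the complement with respect to \<open>\<beta>\<close> into the Euclidean
  orthogonal complement of \<open>W\<close>, whose dimension is known.\<close>

lemma bilinear_dim_complement_le:
  fixes \<beta> :: "'a::euclidean_space \<Rightarrow> 'a \<Rightarrow> real"
  assumes "bilinear \<beta>" and nondeg: "nondegenerate_on \<beta> UNIV" and W: "subspace W"
  shows "dim {v. \<forall>w\<in>W. \<beta> v w = 0} + dim W \<le> DIM('a)"
proof -
  let ?N = "{v. \<forall>w\<in>W. \<beta> v w = 0}"
  \<comment> \<open>The Euclidean Riesz representative of the functional
    \<open>\<beta> v\<close>.\<close>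
  define \<phi> where "\<phi> = (\<lambda>v. \<Sum>b\<in>Basis. \<beta> v b *\<^sub>R b)"
  have lin_r: "linear (\<beta> v)" for v
    using assms(1) unfolding bilinear_def by blast
  have inner: "w \<bullet> \<phi> v = \<beta> v w" for v w
  proof -
    have "\<beta> v w = \<beta> v (\<Sum>b\<in>Basis. (w \<bullet> b) *\<^sub>R b)"
      by (simp add: euclidean_representation)
    also have "\<dots> = (\<Sum>b\<in>Basis. (w \<bullet> b) * \<beta> v b)"
      by (simp add: linear_sum[OF lin_r] linear_cmul[OF lin_r])
    also have "\<dots> = w \<bullet> \<phi> v"
      unfolding \<phi>_def inner_sum_right by (simp add: mult.commute)
    finally show ?thesis ..
  qed
  have lin: "linear \<phi>"
    unfolding \<phi>_def
    by (rule linearI)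
      (simp_all add: bilinear_ladd[OF assms(1)] bilinear_lmul[OF assms(1)] scaleR_add_left
        sum.distrib scaleR_sum_right)
  have "v = 0" if "\<phi> v = 0" for v
    using nondeg inner[of _ v] that unfolding nondegenerate_on_def by simp
  then have "inj \<phi>"
    using linear_injective_0[OF lin] by blast
  then have "inj_on \<phi> (span ?N)"
    by (rule inj_on_subset) simp
  then have "dim ?N = dim (\<phi> ` ?N)"
    using dim_image_eq[OF lin, of ?N] by simp
  also have "\<dots> \<le> dim {y \<in> UNIV. \<forall>x\<in>W. orthogonal x y}"
    by (rule dim_subset) (auto simp: orthogonal_def inner)
  finally show ?thesis
    using dim_subspace_orthogonal_to_vectors[OF W subspace_UNIV] by simp
qed

lemma linear_image_subspace_eq:
  fixes f :: "'a::euclidean_space \<Rightarrow> 'a"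
  assumes "linear f" "subspace S" "S \<subseteq> f ` S"
  shows "f ` S = S"
  using subspace_dim_equal[OF assms(2) linear_subspace_image[OF assms(1,2)] assms(3)]
    dim_image_le[OF assms(1)] by simp

section \<open>Vanishing of the screen and screen transversal bundles\<close>

lemma screen_zero:
  fixes B :: "('k::{t2_space, second_countable_topology}, 'b::euclidean_space) chart set"
  assumes "lightlike_submanifold A g B \<iota> S S' L r" "r = DIM('b)"
  shows "S p = {0}"
proof (rule direct_sum_full_left)
  have sub: "submanifold A B \<iota>" and rad: "distribution_of_rank A B \<iota> r (radical A g B \<iota>)"
    and "orthogonal_sum (g (\<iota> p)) (tangent_space A B \<iota> p) (radical A g B \<iota> p) (S p)"
    using assms(1) unfolding lightlike_submanifold_def by auto
  then show "direct_sum (tangent_space A B \<iota> p) (radical A g B \<iota> p) (S p)"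
    unfolding orthogonal_sum_def by blast
  show "radical A g B \<iota> p = tangent_space A B \<iota> p"
  proof (rule subspace_dim_equal)
    show "subspace (radical A g B \<iota> p)"
      using rad by (rule distribution_of_rank_subspace)
    show "dim (tangent_space A B \<iota> p) \<le> dim (radical A g B \<iota> p)"
      using distribution_of_rank_dim[OF rad] dim_tangent_space[OF sub] assms(2) by simp
  qed (use subspace_tangent_space[OF sub] in \<open>auto simp: radical_def\<close>)
qed

lemma screen_transversal_zero:
  fixes A :: "('m::{t2_space, second_countable_topology}, 'a::euclidean_space) chart set"
    and B :: "('k::{t2_space, second_countable_topology}, 'b::euclidean_space) chart set"
  assumes "semi_riemannian A g q" "lightlike_submanifold A g B \<iota> S S' L r"
    and "r = DIM('a) - DIM('b)"
  shows "S' p = {0}"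
proof (rule direct_sum_full_left)
  have sub: "submanifold A B \<iota>" and rad: "distribution_of_rank A B \<iota> r (radical A g B \<iota>)"
    and "orthogonal_sum (g (\<iota> p)) (normal_space A g B \<iota> p) (radical A g B \<iota> p) (S' p)"
    using assms(2) unfolding lightlike_submanifold_def by auto
  then show "direct_sum (normal_space A g B \<iota> p) (radical A g B \<iota> p) (S' p)"
    unfolding orthogonal_sum_def by blast
  have bil: "bilinear (g (\<iota> p))" and nondeg: "nondegenerate_on (g (\<iota> p)) UNIV"
    using assms(1) unfolding semi_riemannian_def by auto
  show "radical A g B \<iota> p = normal_space A g B \<iota> p"
  proof (rule subspace_dim_equal)
    show "subspace (radical A g B \<iota> p)"
      using rad by (rule distribution_of_rank_subspace)
    show "subspace (normal_space A g B \<iota> p)"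
      unfolding normal_space_def using bil by (rule bilinear_subspace_complement)
    \<comment> \<open>The ambient metric is nondegenerate, so the normal space is no larger than the
      codimension allows.\<close>
    have "dim (normal_space A g B \<iota> p) + DIM('b) \<le> DIM('a)"
      using bilinear_dim_complement_le[OF bil nondeg subspace_tangent_space[OF sub, of p]]
        dim_tangent_space[OF sub, of p] unfolding normal_space_def by simp
    \<comment> \<open>The subtraction in \<open>r = DIM('a) - DIM('b)\<close> is truncated, but the
      bound just obtained implies \<open>DIM('b) \<le> DIM('a)\<close>, so \<open>r\<close> is the
      true codimension.\<close>
    then show "dim (normal_space A g B \<iota> p) \<le> dim (radical A g B \<iota> p)"
      using distribution_of_rank_dim[OF rad, of p] assms(3) by simp
  qed (auto simp: radical_def)
qed

section \<open>The complement \<open>B'\<close> and invariance of the screen\<close>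

lemma bronze_linear: "bronze A g q J \<Longrightarrow> linear (J p)"
  unfolding bronze_def by blast

text \<open>The decomposition of \<open>J Y\<close> is available for smooth sections, not for single
  vectors. A local frame of \<open>B'\<close> around \<open>p\<close> supplies sections whose values
  span the fibre; with \<open>wY = 0\<close> each is mapped into \<open>B' p\<close>, and linearity
  extends this to the span.\<close>

lemma complement_invariant:
  assumes "linear (J (\<iota> p))" "screen_generic_wrt A g J B \<iota> S S' L r B'"
    and S'_zero: "\<And>p. S' p = {0}"
  shows "J (\<iota> p) ` B' p \<subseteq> B' p"
proof -
  have "smooth_distribution A B \<iota> B'"
    using assms(2) unfolding screen_generic_wrt_def nondegenerate_distribution_def by blast
  then obtain k V E where "p \<in> V" and E: "local_frame A B \<iota> V k E B'"
    unfolding smooth_distribution_def distribution_of_rank_def by blast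
  then have V: "open V" and sec: "\<And>i. i < k \<Longrightarrow> E i \<in> sections A B \<iota> V B'"
    and span: "span ((\<lambda>i. E i p) ` {..<k}) = B' p"
    unfolding local_frame_def by auto
  have "J (\<iota> p) (E i p) \<in> B' p" if i: "i < k" for i
  proof -
    obtain fY wY where "fY \<in> sections A B \<iota> V B'" "wY \<in> sections A B \<iota> V S'"
      and dec: "\<forall>x\<in>V. J (\<iota> x) (E i x) = fY x + wY x"
      using assms(2) V sec[OF i] unfolding screen_generic_wrt_def by meson
    then have "fY p \<in> B' p" "wY p = 0"
      using \<open>p \<in> V\<close> S'_zero unfolding sections_def by auto
    then show ?thesis
      using dec \<open>p \<in> V\<close> by simp
  qed
  then have "span (J (\<iota> p) ` (\<lambda>i. E i p) ` {..<k}) \<subseteq> B' p"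
    by (intro span_minimal local_frame_subspace[OF E \<open>p \<in> V\<close>]) auto
  then show ?thesis
    using linear_span_image[OF assms(1)] span by metis
qed

lemma complement_zero:
  fixes A :: "('m::{t2_space, second_countable_topology}, 'a::euclidean_space) chart set"
    and B :: "('k::{t2_space, second_countable_topology}, 'b::euclidean_space) chart set"
  assumes "bronze A g q J" and gen: "screen_generic_wrt A g J B \<iota> S S' L r B'"
    and "r = DIM('b) \<or> r = DIM('a) - DIM('b)"
  shows "B' p = {0}"
proof -
  have light: "lightlike_submanifold A g B \<iota> S S' L r"
    and sum: "\<And>p. direct_sum (S p) (Bo J \<iota> S p) (B' p)"
    and proper: "(\<exists>p. B' p \<noteq> {0}) \<Longrightarrow> \<not> (\<forall>p. J (\<iota> p) ` B' p \<subseteq> S p)"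
    using gen unfolding screen_generic_wrt_def by auto
  from assms(3) show ?thesis
  proof
    assume "r = DIM('b)"
    then have "S p = {0}"
      by (rule screen_zero[OF light])
    then show ?thesis
      using direct_sum_subset(2)[OF sum, of p] sum[of p] unfolding direct_sum_def by auto
  next
    assume "r = DIM('a) - DIM('b)"
    moreover have "semi_riemannian A g q"
      using assms(1) unfolding bronze_def by blast
    ultimately have "S' p = {0}" for p
      using screen_transversal_zero[OF _ light] by blast
    \<comment> \<open>The clause to be contradicted forbids the inclusion of whole bundles, so the
      inclusion is needed at every point, not only at the given one.\<close>
    then have "J (\<iota> p) ` B' p \<subseteq> S p" for p
      using complement_invariant[where p = p, OF bronze_linear[OF assms(1)] gen]
        direct_sum_subset(2)[OF sum, of p] by blast
    then show ?thesis
      using proper by blast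
  qed
qed

lemma screen_generic_invariant:
  fixes A :: "('m::{t2_space, second_countable_topology}, 'a::euclidean_space) chart set"
    and B :: "('k::{t2_space, second_countable_topology}, 'b::euclidean_space) chart set"
  assumes "bronze A g q J" and gen: "screen_generic_wrt A g J B \<iota> S S' L r B'"
    and "r = DIM('b) \<or> r = DIM('a) - DIM('b)"
  shows "invariant_lightlike A g J B \<iota> S S' L r"
proof -
  have light: "lightlike_submanifold A g B \<iota> S S' L r"
    and rad: "\<forall>p. J (\<iota> p) ` radical A g B \<iota> p = radical A g B \<iota> p"
    and sum: "\<And>p. direct_sum (S p) (Bo J \<iota> S p) (B' p)"
    using gen unfolding screen_generic_wrt_def by auto
  have "J (\<iota> p) ` S p = S p" for p
  proof (rule linear_image_subspace_eq)
    show "linear (J (\<iota> p))"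
      using assms(1) by (rule bronze_linear)
    show "subspace (S p)"
      using light unfolding lightlike_submanifold_def by (blast intro: smooth_distribution_subspace)
    have "S p = Bo J \<iota> S p"
      using sum[of p] complement_zero[OF assms] by (simp add: direct_sum_zero_right)
    then show "S p \<subseteq> J (\<iota> p) ` S p"
      unfolding Bo_def by blast
  qed
  then show ?thesis
    using light rad unfolding invariant_lightlike_def by blast
qed

theorem proposition5p2:
  fixes A :: "('m::{t2_space, second_countable_topology}, 'a::euclidean_space) chart set"
    and g :: "'m \<Rightarrow> 'a \<Rightarrow> 'a \<Rightarrow> real" and q :: nat and J :: "'m \<Rightarrow> 'a \<Rightarrow> 'a"
  assumes "locally_bronze A g q J"
  shows "(\<nexists>(B :: ('k::{t2_space, second_countable_topology}, 'b::euclidean_space) chart set) \<iota> S S' L r.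
            proper_screen_generic A g J B \<iota> S S' L r \<and>
            (coisotropic r DIM('b) (DIM('a) - DIM('b)) \<or>
             isotropic r DIM('b) (DIM('a) - DIM('b)) \<or>
             totally_lightlike r DIM('b) (DIM('a) - DIM('b))))
       \<and> (\<forall>(B :: ('k, 'b) chart set) \<iota> S S' L r.
            screen_generic A g J B \<iota> S S' L r \<and>
            (isotropic r DIM('b) (DIM('a) - DIM('b)) \<or>
             coisotropic r DIM('b) (DIM('a) - DIM('b)) \<or>
             totally_lightlike r DIM('b) (DIM('a) - DIM('b)))
            \<longrightarrow> invariant_lightlike A g J B \<iota> S S' L r)"
proof -
  have bronze: "bronze A g q J"
    using assms unfolding locally_bronze_def by blast
  \<comment> \<open>Isotropic and totally lightlike submanifolds have a radical of full rank; in the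
    coisotropic case the rank is the codimension.\<close>
  have rank: "r = DIM('b) \<or> r = DIM('a) - DIM('b)"
    if "coisotropic r DIM('b) (DIM('a) - DIM('b)) \<or> isotropic r DIM('b) (DIM('a) - DIM('b)) \<or>
      totally_lightlike r DIM('b) (DIM('a) - DIM('b))" for r
    using that unfolding coisotropic_def isotropic_def totally_lightlike_def by blast
  show ?thesis
  proof (intro conjI notI allI impI)
    assume "\<exists>(B :: ('k, 'b) chart set) \<iota> S S' L r.
      proper_screen_generic A g J B \<iota> S S' L r \<and>
      (coisotropic r DIM('b) (DIM('a) - DIM('b)) \<or>
       isotropic r DIM('b) (DIM('a) - DIM('b)) \<or>
       totally_lightlike r DIM('b) (DIM('a) - DIM('b)))"
    then obtain B :: "('k, 'b) chart set" and \<iota> S S' L r B' p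
      where "screen_generic_wrt A g J B \<iota> S S' L r B'" "B' p \<noteq> {0}"
        and "r = DIM('b) \<or> r = DIM('a) - DIM('b)"
      unfolding proper_screen_generic_def using rank by blast
    \<comment> \<open>Properness supplies a nonzero fibre of \<open>B'\<close>, which the rank
      condition excludes.\<close>
    then show False
      using complement_zero[OF bronze] by blast
  next
    fix B :: "('k, 'b) chart set" and \<iota> S S' L r
    assume "screen_generic A g J B \<iota> S S' L r \<and>
      (isotropic r DIM('b) (DIM('a) - DIM('b)) \<or>
       coisotropic r DIM('b) (DIM('a) - DIM('b)) \<or>
       totally_lightlike r DIM('b) (DIM('a) - DIM('b)))"
    then obtain B' where "screen_generic_wrt A g J B \<iota> S S' L r B'"
        and "r = DIM('b) \<or> r = DIM('a) - DIM('b)"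
      unfolding screen_generic_def using rank by blast
    then show "invariant_lightlike A g J B \<iota> S S' L r"
      by (rule screen_generic_invariant[OF bronze])
  qed
qed

end
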